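(* Let $G$ be a finite group and $H\le G$ a subgroup. Then \[\Theta\cap\mathbb{R}[G]=\bigcup_{e\in E^\bullet(H)\cap\mathbb{R}[H]}\Theta(e)\cap\mathbb{R}[G].\]
   Context: $\eta_H=|H|^{-1}\sum_{h\in H}h$, and $E^\bullet(H)$ is the set of idempotents $e\in\mathbb{C}[H]$ with $\eta_He=\eta_H$. For $e\in E^\bullet(H)$, $\Theta(e)=\{w\in\mathbb{C}[G]:ew(1-e)=0,\ (e-\eta_H)w\eta_H=0\}$, and $\Theta=\bigcup_{e\in E^\bullet(H)}\Theta(e)$. *)

theory Defs
  imports Complex_Main "HOL-Algebra.Ring" "HOL-Algebra.Coset"
begin

text \<open>
  The complex group algebra of a finite group \<open>G\<close>. The element
  \<open>\<Sum>g\<in>G. f(g) g\<close> is represented by its coefficient function \<open>f\<close>, which is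
  required to vanish outside the carrier, so that equality of functions is equality in the algebra;
  multiplication is convolution. The construction is only meaningful for finite \<open>G\<close>.
\<close>

definition group_algebra :: "('a, 'm) monoid_scheme \<Rightarrow> ('a \<Rightarrow> complex) ring" where
  "group_algebra G =
     \<lparr>carrier = {f. \<forall>x. x \<notin> carrier G \<longrightarrow> f x = 0},
      mult = (\<lambda>f g x. if x \<in> carrier G
                then (\<Sum>y\<in>carrier G. f y * g (inv\<^bsub>G\<^esub> y \<otimes>\<^bsub>G\<^esub> x)) else 0),
      one = (\<lambda>x. if x = \<one>\<^bsub>G\<^esub> then 1 else 0),
      zero = (\<lambda>x. 0),
      add = (\<lambda>f g x. f x + g x)\<rparr>"

definition real_group_algebra :: "('a, 'm) monoid_scheme \<Rightarrow> ('a \<Rightarrow> complex) set" where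
  "real_group_algebra G = {f \<in> carrier (group_algebra G). \<forall>x. f x \<in> \<real>}"

definition subgroup_avg :: "'a set \<Rightarrow> 'a \<Rightarrow> complex" where
  "subgroup_avg H = (\<lambda>x. if x \<in> H then 1 / of_nat (card H) else 0)"

text \<open>
  For a subgroup \<open>H\<close> of \<open>G\<close>, the carrier of the group algebra of \<open>G\<lparr>carrier := H\<rparr>\<close> consists of the
  elements of the group algebra of \<open>G\<close> supported on \<open>H\<close>. It is treated as a subalgebra, that is,
  products are formed in the group algebra of \<open>G\<close>; lemma \<open>group_algebra_subgroup_mult\<close> below shows
  that this is the multiplication of the group algebra of \<open>H\<close>.
\<close>

definition E_bullet :: "('a, 'm) monoid_scheme \<Rightarrow> 'a set \<Rightarrow> ('a \<Rightarrow> complex) set" where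
  "E_bullet G H =
     {e \<in> carrier (group_algebra (G\<lparr>carrier := H\<rparr>)).
        e \<otimes>\<^bsub>group_algebra G\<^esub> e = e \<and>
        subgroup_avg H \<otimes>\<^bsub>group_algebra G\<^esub> e = subgroup_avg H}"

definition Theta_of :: "('a, 'm) monoid_scheme \<Rightarrow> 'a set \<Rightarrow> ('a \<Rightarrow> complex) \<Rightarrow> ('a \<Rightarrow> complex) set" where
  "Theta_of G H e =
     {w \<in> carrier (group_algebra G).
        e \<otimes>\<^bsub>group_algebra G\<^esub> w \<otimes>\<^bsub>group_algebra G\<^esub> (\<one>\<^bsub>group_algebra G\<^esub> \<ominus>\<^bsub>group_algebra G\<^esub> e)
          = \<zero>\<^bsub>group_algebra G\<^esub> \<and>
        (e \<ominus>\<^bsub>group_algebra G\<^esub> subgroup_avg H) \<otimes>\<^bsub>group_algebra G\<^esub> w \<otimes>\<^bsub>group_algebra G\<^esub> subgroup_avg H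
          = \<zero>\<^bsub>group_algebra G\<^esub>}"

definition Theta :: "('a, 'm) monoid_scheme \<Rightarrow> 'a set \<Rightarrow> ('a \<Rightarrow> complex) set" where
  "Theta G H = (\<Union>e\<in>E_bullet G H. Theta_of G H e)"

lemma group_algebra_ring:
  fixes G (structure)
  assumes "group G" and fin: "finite (carrier G)"
  shows "ring (group_algebra G)"
proof -
  interpret group G by fact
  let ?C = "{f :: 'a \<Rightarrow> complex. \<forall>x. x \<notin> carrier G \<longrightarrow> f x = 0}"
  let ?m = "\<lambda>(f :: 'a \<Rightarrow> complex) g x. if x \<in> carrier G
              then (\<Sum>y\<in>carrier G. f y * g (inv y \<otimes> x)) else 0"
  let ?u = "\<lambda>x. if x = \<one> then 1 else (0::complex)"
  have assoc: "?m (?m f g) h = ?m f (?m g h)" for f g h :: "'a \<Rightarrow> complex"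
  proof
    fix x
    show "?m (?m f g) h x = ?m f (?m g h) x"
    proof (cases "x \<in> carrier G")
      case x: True
      have inner: "(\<Sum>y\<in>carrier G. g (inv z \<otimes> y) * h (inv y \<otimes> x)) =
                   (\<Sum>u\<in>carrier G. g u * h (inv u \<otimes> (inv z \<otimes> x)))"
        if z: "z \<in> carrier G" for z
      proof (rule sum.reindex_bij_witness[where i = "\<lambda>u. z \<otimes> u" and j = "\<lambda>y. inv z \<otimes> y"])
        fix y assume y: "y \<in> carrier G"
        have "inv (inv z \<otimes> y) \<otimes> (inv z \<otimes> x) = inv y \<otimes> (z \<otimes> (inv z \<otimes> x))"
          using x y z by (simp add: inv_mult_group m_assoc)
        also have "\<dots> = inv y \<otimes> x"
          using x y z by (simp add: m_assoc[symmetric])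
        finally show "g (inv z \<otimes> y) * h (inv (inv z \<otimes> y) \<otimes> (inv z \<otimes> x)) =
                      g (inv z \<otimes> y) * h (inv y \<otimes> x)"
          by simp
      qed (use z in \<open>auto simp: m_assoc[symmetric]\<close>)
      have "?m (?m f g) h x =
            (\<Sum>y\<in>carrier G. \<Sum>z\<in>carrier G. f z * (g (inv z \<otimes> y) * h (inv y \<otimes> x)))"
        using x by (simp add: sum_distrib_right mult.assoc)
      also have "\<dots> = (\<Sum>z\<in>carrier G. f z * (\<Sum>y\<in>carrier G. g (inv z \<otimes> y) * h (inv y \<otimes> x)))"
        by (subst sum.swap) (simp add: sum_distrib_left)
      also have "\<dots> = ?m f (?m g h) x"
        using x by (simp add: inner)
      finally show ?thesis .
    qed simp
  qed
  have unit_l: "?m ?u f = f" if f: "f \<in> ?C" for f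
  proof
    fix x
    have "(\<Sum>y\<in>carrier G. ?u y * f (inv y \<otimes> x)) = (\<Sum>y\<in>{\<one>}. f (inv y \<otimes> x))"
      by (rule sum.mono_neutral_cong_right) (use fin in auto)
    then show "?m ?u f x = f x"
      using f by simp
  qed
  have unit_r: "?m f ?u = f" if f: "f \<in> ?C" for f
  proof
    fix x
    have "(\<Sum>y\<in>carrier G. f y * ?u (inv y \<otimes> x)) = (\<Sum>y\<in>{x}. f y)" if x: "x \<in> carrier G"
    proof (rule sum.mono_neutral_cong_right)
      show "\<forall>y\<in>carrier G - {x}. f y * ?u (inv y \<otimes> x) = 0"
        using x by (auto simp: inv_solve_left')
    qed (use fin x in auto)
    then show "?m f ?u x = f x"
      using f by auto
  qed
  show ?thesis
  proof (rule ringI)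
    show "abelian_group (group_algebra G)"
    proof (rule abelian_groupI)
      fix f assume "f \<in> carrier (group_algebra G)"
      then show "\<exists>g\<in>carrier (group_algebra G). g \<oplus>\<^bsub>group_algebra G\<^esub> f = \<zero>\<^bsub>group_algebra G\<^esub>"
        by (intro bexI[of _ "\<lambda>x. - f x"]) (auto simp: group_algebra_def)
    qed (auto simp: group_algebra_def fun_eq_iff)
    show "Group.monoid (group_algebra G)"
      by (rule monoidI) (use assoc unit_l unit_r in \<open>auto simp: group_algebra_def\<close>)
  qed (auto simp: group_algebra_def fun_eq_iff algebra_simps sum.distrib)
qed

lemma group_algebra_subgroup_mult:
  assumes "group G" "finite (carrier G)" and H: "subgroup H G"
    and f: "f \<in> carrier (group_algebra (G\<lparr>carrier := H\<rparr>))"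
    and g: "g \<in> carrier (group_algebra (G\<lparr>carrier := H\<rparr>))"
  shows "f \<otimes>\<^bsub>group_algebra (G\<lparr>carrier := H\<rparr>)\<^esub> g = f \<otimes>\<^bsub>group_algebra G\<^esub> g"
proof
  interpret group G by fact
  interpret subgroup H G by fact
  fix x
  have eq: "(\<Sum>y\<in>carrier G. f y * g (inv\<^bsub>G\<^esub> y \<otimes>\<^bsub>G\<^esub> x)) =
            (\<Sum>y\<in>H. f y * g (inv\<^bsub>G\<lparr>carrier := H\<rparr>\<^esub> y \<otimes>\<^bsub>G\<^esub> x))"
    by (rule sum.mono_neutral_cong_right)
       (use assms(2) f subset H in \<open>auto simp: group_algebra_def m_inv_consistent\<close>)
  have "f y * g (inv\<^bsub>G\<^esub> y \<otimes>\<^bsub>G\<^esub> x) = 0" if "x \<in> carrier G" "x \<notin> H" "y \<in> carrier G" for y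
  proof (cases "y \<in> H")
    case True
    have "inv\<^bsub>G\<^esub> y \<otimes>\<^bsub>G\<^esub> x \<notin> H"
    proof
      assume "inv\<^bsub>G\<^esub> y \<otimes>\<^bsub>G\<^esub> x \<in> H"
      then have "y \<otimes>\<^bsub>G\<^esub> (inv\<^bsub>G\<^esub> y \<otimes>\<^bsub>G\<^esub> x) \<in> H" using True by blast
      then show False using that by (simp add: m_assoc[symmetric])
    qed
    then show ?thesis using g by (simp add: group_algebra_def)
  qed (use f in \<open>simp add: group_algebra_def\<close>)
  then have "(\<Sum>y\<in>carrier G. f y * g (inv\<^bsub>G\<^esub> y \<otimes>\<^bsub>G\<^esub> x)) = 0" if "x \<in> carrier G" "x \<notin> H"
    using that by (intro sum.neutral) blast
  with eq show "(f \<otimes>\<^bsub>group_algebra (G\<lparr>carrier := H\<rparr>)\<^esub> g) x = (f \<otimes>\<^bsub>group_algebra G\<^esub> g) x"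
    using subset by (auto simp: group_algebra_def)
qed

end

theory Submission
  imports Defs "HOL-Algebra.Multiplicative_Group" "HOL-Library.Function_Algebras"
begin

text \<open>
  Let \<open>w\<close> be real and \<open>w \<in> \<Theta>(e)\<close>. The defining equations are stable under complex conjugation of
  the coefficients, so \<open>w\<close> also lies in \<open>\<Theta>(e')\<close>, where \<open>e'\<close> is the conjugate of \<open>e\<close>.

  What the equations say about \<open>e\<close> depends only on the left ideal \<open>\<complex>[H]e\<close>: the first says that
  right multiplication by \<open>w\<close> maps \<open>\<complex>[G]e\<close> into itself, and the second that \<open>e w \<eta> = \<eta> w \<eta>\<close>. Both
  pass from \<open>e\<close> and \<open>e'\<close> to an idempotent generator \<open>f\<close> of the join \<open>J = \<complex>[H]e + \<complex>[H]e'\<close>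
  (lemma \<open>join_of_left_ideals_inherits\<close>). For the second this uses that \<open>\<eta>\<close> is central in \<open>\<complex>[H]\<close>:
  if \<open>f = a e + b e'\<close>, then \<open>f w \<eta> = (a + b) \<eta> w \<eta>\<close>, and \<open>(a + b) \<eta> = f \<eta> = \<eta>\<close>.

  The point of the join is that \<open>J\<close> is stable under conjugation, and a left ideal with this property
  is generated by a real idempotent. Indeed, by Maschke's theorem some \<open>f \<in> J\<close> is a right identity
  on \<open>J\<close> (lemma \<open>left_ideal_has_right_identity\<close>). The conjugate of \<open>f\<close> is another one, and
  right identities form an affine space, so the real part of \<open>f\<close> is a right identity too
  (lemma \<open>conj_stable_left_ideal_has_real_right_identity\<close>).
\<close>

section \<open>Left ideals of the group algebra\<close>

lemma sum_functions_apply: "(\<Sum>i\<in>I. F i) x = (\<Sum>i\<in>I. (F i x :: complex))"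
  by (induction I rule: infinite_finite_induct) auto

text \<open>
  This is the element \<open>c h\<close> of the group algebra; with \<open>h = \<one>\<close> it serves as the scalar \<open>c\<close>.
\<close>

definition point_mass :: "'a \<Rightarrow> complex \<Rightarrow> 'a \<Rightarrow> complex" where
  "point_mass h c = (\<lambda>x. if x = h then c else 0)"

lemma point_mass_carrier:
  "h \<in> carrier G \<Longrightarrow> point_mass h c \<in> carrier (group_algebra G)"
  by (auto simp: group_algebra_def point_mass_def)

lemma point_mass_mult:
  assumes "finite (carrier G)" "h \<in> carrier G"
  shows "point_mass h c \<otimes>\<^bsub>group_algebra G\<^esub> g =
    (\<lambda>x. if x \<in> carrier G then c * g (inv\<^bsub>G\<^esub> h \<otimes>\<^bsub>G\<^esub> x) else 0)"
proof -
  have "(\<Sum>y\<in>carrier G. point_mass h c y * g (inv\<^bsub>G\<^esub> y \<otimes>\<^bsub>G\<^esub> x)) =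
        (\<Sum>y\<in>{h}. c * g (inv\<^bsub>G\<^esub> y \<otimes>\<^bsub>G\<^esub> x))" for x
    by (rule sum.mono_neutral_cong_right) (use assms in \<open>auto simp: point_mass_def\<close>)
  then show ?thesis
    by (auto simp: group_algebra_def fun_eq_iff)
qed

lemma scalar_mult:
  assumes "group G" "finite (carrier G)" "g \<in> carrier (group_algebra G)"
  shows "point_mass \<one>\<^bsub>G\<^esub> c \<otimes>\<^bsub>group_algebra G\<^esub> g = (\<lambda>x. c * g x)"
proof -
  interpret group G by fact
  show ?thesis
    using assms by (subst point_mass_mult) (auto simp: group_algebra_def fun_eq_iff)
qed

text \<open>
  This is Maschke's averaging argument. Let \<open>p\<close> be a linear projection onto \<open>J\<close>. Its average
  \<open>P(y) = |G|\<^sup>-\<^sup>1 \<Sum>\<^sub>h h p(h\<^sup>-\<^sup>1 y)\<close> is still a projection onto \<open>J\<close> and is linear over the group algebra, so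
  \<open>x = P(x) = x P(1)\<close> for \<open>x \<in> J\<close>. Hence \<open>f = P(1)\<close> is as required.
\<close>

lemma left_ideal_has_right_identity:
  fixes G :: "('a, 'm) monoid_scheme" (structure)
  defines "A \<equiv> group_algebra G"
  assumes "group G" and fin: "finite (carrier G)"
    and sub: "J \<subseteq> carrier A" and zero: "\<zero>\<^bsub>A\<^esub> \<in> J"
    and add: "\<And>x y. x \<in> J \<Longrightarrow> y \<in> J \<Longrightarrow> x \<oplus>\<^bsub>A\<^esub> y \<in> J"
    and mult: "\<And>r x. r \<in> carrier A \<Longrightarrow> x \<in> J \<Longrightarrow> r \<otimes>\<^bsub>A\<^esub> x \<in> J"
  obtains f where "f \<in> J" and "\<And>x. x \<in> J \<Longrightarrow> x \<otimes>\<^bsub>A\<^esub> f = x"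
proof -
  interpret group G by fact
  interpret vector_space "\<lambda>(c::complex) (f::'a \<Rightarrow> complex) x. c * f x"
    by unfold_locales (auto simp: fun_eq_iff algebra_simps)
  interpret P: vector_space_pair "\<lambda>(c::complex) (f::'a \<Rightarrow> complex) x. c * f x"
    "\<lambda>(c::complex) (f::'a \<Rightarrow> complex) x. c * f x" ..
  have J: "subspace J"
  proof (rule subspaceI)
    show "0 \<in> J" using zero by (simp add: A_def group_algebra_def zero_fun_def)
    show "x + y \<in> J" if "x \<in> J" "y \<in> J" for x y
      using add[OF that] by (simp add: A_def group_algebra_def plus_fun_def)
    show "(\<lambda>x. c * g x) \<in> J" if "g \<in> J" for c g
    proof -
      have "point_mass \<one> c \<otimes>\<^bsub>A\<^esub> g \<in> J"
        using that by (intro mult) (auto simp: A_def point_mass_carrier)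
      then show ?thesis
        using that sub scalar_mult[OF \<open>group G\<close> fin] by (auto simp: A_def)
    qed
  qed
  \<comment> \<open>A linear left inverse of the inclusion of \<open>J\<close> is a projection onto \<open>J\<close>. It is defined on the space
    of all functions, including those that do not vanish outside the group.\<close>
  obtain p where p_J: "\<And>x. p x \<in> J"
    and p_lin: "Vector_Spaces.linear (\<lambda>c f x. c * f x) (\<lambda>c f x. c * f x) p"
    and p_id: "\<And>x. x \<in> J \<Longrightarrow> p x = x"
    using P.linear_exists_left_inverse_on[OF linear_id J] by auto
  interpret p: Vector_Spaces.linear "\<lambda>c f x. c * f x" "\<lambda>c f x. c * f x" p
    by (rule p_lin)
  define n :: complex where "n = of_nat (card (carrier G))"
  have n: "n \<noteq> 0"
    using fin by (auto simp: n_def)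
  define f where "f = (\<Sum>h\<in>carrier G. point_mass h (1 / n) \<otimes>\<^bsub>A\<^esub> p (point_mass (inv h) 1))"
  have f_apply: "f z = (\<Sum>h\<in>carrier G. p (point_mass (inv h) 1) (inv h \<otimes> z)) / n"
    if "z \<in> carrier G" for z
    using that unfolding f_def sum_functions_apply A_def
    by (simp add: point_mass_mult fin sum_divide_distrib)
  show thesis
  proof
    show "f \<in> J"
      unfolding f_def by (intro subspace_sum J mult p_J) (auto simp: A_def point_mass_carrier)
    fix x assume x: "x \<in> J"
    \<comment> \<open>The values of \<open>p\<close> at group elements determine \<open>p(h\<^sup>-\<^sup>1 x)\<close>, and \<open>p\<close> fixes \<open>h\<^sup>-\<^sup>1 x \<in> J\<close>.\<close>
    have expand: "(\<Sum>k\<in>carrier G. x k * p (point_mass (inv h \<otimes> k) 1) y) =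
        (point_mass (inv h) 1 \<otimes>\<^bsub>A\<^esub> x) y" if h: "h \<in> carrier G" for h y
    proof -
      have "(\<Sum>k\<in>carrier G. x k * point_mass (inv h \<otimes> k) 1 z) =
          (point_mass (inv h) 1 \<otimes>\<^bsub>A\<^esub> x) z" for z
      proof (cases "z \<in> carrier G")
        case z: True
        have "(\<Sum>k\<in>carrier G. x k * point_mass (inv h \<otimes> k) 1 z) = (\<Sum>k\<in>{h \<otimes> z}. x k)"
          by (rule sum.mono_neutral_cong_right)
             (use z h fin in \<open>auto simp: point_mass_def m_assoc[symmetric]\<close>)
        then show ?thesis
          using z h fin by (simp add: A_def point_mass_mult)
      next
        case z: False
        then have "x k * point_mass (inv h \<otimes> k) 1 z = 0" if "k \<in> carrier G" for k
          using that h by (auto simp: point_mass_def)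
        then have "(\<Sum>k\<in>carrier G. x k * point_mass (inv h \<otimes> k) 1 z) = 0"
          by (intro sum.neutral ballI)
        then show ?thesis
          using z h fin by (simp add: A_def point_mass_mult)
      qed
      then have "(\<Sum>k\<in>carrier G. (\<lambda>z. x k * point_mass (inv h \<otimes> k) 1 z)) =
          point_mass (inv h) 1 \<otimes>\<^bsub>A\<^esub> x"
        by (simp add: fun_eq_iff sum_functions_apply)
      moreover have "p (point_mass (inv h) 1 \<otimes>\<^bsub>A\<^esub> x) = point_mass (inv h) 1 \<otimes>\<^bsub>A\<^esub> x"
        using h x by (intro p_id mult) (auto simp: A_def point_mass_carrier)
      moreover have "p (\<Sum>k\<in>carrier G. (\<lambda>z. x k * point_mass (inv h \<otimes> k) 1 z)) =
          (\<Sum>k\<in>carrier G. (\<lambda>z. x k * p (point_mass (inv h \<otimes> k) 1) z))"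
        by (simp only: p.sum p.scale)
      ultimately have "(\<Sum>k\<in>carrier G. (\<lambda>z. x k * p (point_mass (inv h \<otimes> k) 1) z)) =
          point_mass (inv h) 1 \<otimes>\<^bsub>A\<^esub> x"
        by simp
      then show ?thesis
        by (simp only: fun_eq_iff sum_functions_apply)
    qed
    show "x \<otimes>\<^bsub>A\<^esub> f = x"
    proof
      fix z
      show "(x \<otimes>\<^bsub>A\<^esub> f) z = x z"
      proof (cases "z \<in> carrier G")
        case z: True
        \<comment> \<open>The substitution \<open>h \<mapsto> k\<^sup>-\<^sup>1 h\<close> is what makes the averaged projection commute with left
          multiplication by \<open>k\<close>.\<close>
        have reindex: "(\<Sum>h\<in>carrier G. p (point_mass (inv h) 1) (inv h \<otimes> (inv k \<otimes> z))) =
            (\<Sum>h\<in>carrier G. p (point_mass (inv h \<otimes> k) 1) (inv h \<otimes> z))"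
          if k: "k \<in> carrier G" for k
          by (rule sum.reindex_bij_witness[where i = "\<lambda>h. inv k \<otimes> h" and j = "\<lambda>h. k \<otimes> h"])
             (use k z in \<open>auto simp: inv_mult_group m_assoc[symmetric]\<close>,
              simp add: m_assoc)
        have "(x \<otimes>\<^bsub>A\<^esub> f) z = (\<Sum>k\<in>carrier G. x k * f (inv k \<otimes> z))"
          using z by (simp add: A_def group_algebra_def)
        also have "\<dots> = (\<Sum>k\<in>carrier G. \<Sum>h\<in>carrier G.
            x k * p (point_mass (inv h \<otimes> k) 1) (inv h \<otimes> z)) / n"
          using z by (simp add: f_apply reindex sum_distrib_left sum_divide_distrib)
        also have "\<dots> = (\<Sum>h\<in>carrier G. (point_mass (inv h) 1 \<otimes>\<^bsub>A\<^esub> x) (inv h \<otimes> z)) / n"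
          by (subst sum.swap) (simp add: expand)
        also have "\<dots> = (\<Sum>h\<in>carrier G. x z) / n"
          using z fin by (simp add: A_def point_mass_mult m_assoc[symmetric])
        also have "\<dots> = x z"
          using n by (simp add: n_def)
        finally show ?thesis .
      next
        case False
        then show ?thesis
          using sub x by (auto simp: A_def group_algebra_def)
      qed
    qed
  qed
qed

section \<open>Complex conjugation of coefficients\<close>

definition conj_fun :: "('a \<Rightarrow> complex) \<Rightarrow> 'a \<Rightarrow> complex" where
  "conj_fun f = (\<lambda>x. cnj (f x))"

lemma conj_fun_carrier:
  "f \<in> carrier (group_algebra G) \<Longrightarrow> conj_fun f \<in> carrier (group_algebra G)"
  by (simp add: conj_fun_def group_algebra_def)

lemma conj_fun_conj_fun [simp]: "conj_fun (conj_fun f) = f"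
  by (simp add: conj_fun_def)

lemma conj_fun_mult:
  "conj_fun (f \<otimes>\<^bsub>group_algebra G\<^esub> g) = conj_fun f \<otimes>\<^bsub>group_algebra G\<^esub> conj_fun g"
  by (auto simp: conj_fun_def group_algebra_def fun_eq_iff)

lemma conj_fun_add:
  "conj_fun (f \<oplus>\<^bsub>group_algebra G\<^esub> g) = conj_fun f \<oplus>\<^bsub>group_algebra G\<^esub> conj_fun g"
  by (auto simp: conj_fun_def group_algebra_def fun_eq_iff)

lemma conj_fun_zero: "conj_fun \<zero>\<^bsub>group_algebra G\<^esub> = \<zero>\<^bsub>group_algebra G\<^esub>"
  by (auto simp: conj_fun_def group_algebra_def fun_eq_iff)

lemma conj_fun_one: "conj_fun \<one>\<^bsub>group_algebra G\<^esub> = \<one>\<^bsub>group_algebra G\<^esub>"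
  by (auto simp: conj_fun_def group_algebra_def fun_eq_iff)

lemma conj_fun_subgroup_avg: "conj_fun (subgroup_avg H) = subgroup_avg H"
  by (auto simp: conj_fun_def subgroup_avg_def fun_eq_iff)

lemma real_group_algebra_iff:
  "f \<in> real_group_algebra G \<longleftrightarrow> f \<in> carrier (group_algebra G) \<and> conj_fun f = f"
  by (simp add: real_group_algebra_def conj_fun_def fun_eq_iff Reals_cnj_iff)

lemma group_algebra_uminus:
  assumes "group G" "finite (carrier G)" "g \<in> carrier (group_algebra G)"
  shows "\<ominus>\<^bsub>group_algebra G\<^esub> g = (\<lambda>x. - g x)"
proof -
  interpret ring "group_algebra G" using assms by (intro group_algebra_ring)
  show ?thesis
    by (rule minus_equality) (use assms(3) in \<open>auto simp: group_algebra_def\<close>)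
qed

lemma conj_fun_minus:
  assumes "group G" "finite (carrier G)" "g \<in> carrier (group_algebra G)"
  shows "conj_fun (f \<ominus>\<^bsub>group_algebra G\<^esub> g) = conj_fun f \<ominus>\<^bsub>group_algebra G\<^esub> conj_fun g"
  using group_algebra_uminus[OF assms]
    group_algebra_uminus[OF assms(1,2) conj_fun_carrier[OF assms(3)]]
  by (simp add: a_minus_def conj_fun_add) (simp add: conj_fun_def)

text \<open>
  If \<open>f\<close> is a right identity on \<open>J\<close>, then so is its conjugate, by conjugating \<open>x f = x\<close> and using that
  conjugation permutes \<open>J\<close>. The mean of the two is real.
\<close>

lemma conj_stable_left_ideal_has_real_right_identity:
  fixes G :: "('a, 'm) monoid_scheme" (structure)
  defines "A \<equiv> group_algebra G"
  assumes "group G" and fin: "finite (carrier G)"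
    and sub: "J \<subseteq> carrier A" and zero: "\<zero>\<^bsub>A\<^esub> \<in> J"
    and add: "\<And>x y. x \<in> J \<Longrightarrow> y \<in> J \<Longrightarrow> x \<oplus>\<^bsub>A\<^esub> y \<in> J"
    and mult: "\<And>r x. r \<in> carrier A \<Longrightarrow> x \<in> J \<Longrightarrow> r \<otimes>\<^bsub>A\<^esub> x \<in> J"
    and conj: "\<And>x. x \<in> J \<Longrightarrow> conj_fun x \<in> J"
  obtains f where "f \<in> J" and "f \<in> real_group_algebra G"
    and "\<And>x. x \<in> J \<Longrightarrow> x \<otimes>\<^bsub>A\<^esub> f = x"
proof -
  interpret group G by fact
  obtain f where f: "f \<in> J" and id: "\<And>x. x \<in> J \<Longrightarrow> x \<otimes>\<^bsub>A\<^esub> f = x"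
    using left_ideal_has_right_identity[OF \<open>group G\<close> fin, folded A_def, OF sub zero add mult]
    by blast
  define r where "r = (\<lambda>x. 1/2 * (f \<oplus>\<^bsub>A\<^esub> conj_fun f) x)"
  have "f \<oplus>\<^bsub>A\<^esub> conj_fun f \<in> J"
    using f by (intro add conj)
  then have "point_mass \<one> (1/2) \<otimes>\<^bsub>A\<^esub> (f \<oplus>\<^bsub>A\<^esub> conj_fun f) \<in> J"
    by (intro mult) (auto simp: A_def point_mass_carrier)
  then have r_J: "r \<in> J"
    using scalar_mult[OF \<open>group G\<close> fin, of "f \<oplus>\<^bsub>A\<^esub> conj_fun f" "1/2"]
      \<open>f \<oplus>\<^bsub>A\<^esub> conj_fun f \<in> J\<close> sub by (auto simp: A_def r_def)
  moreover have "conj_fun r = r"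
    by (auto simp: r_def A_def conj_fun_def group_algebra_def fun_eq_iff)
  then have "r \<in> real_group_algebra G"
    using r_J sub by (auto simp: real_group_algebra_iff A_def)
  moreover have "x \<otimes>\<^bsub>A\<^esub> r = x" if x: "x \<in> J" for x
  proof
    fix z
    have "x \<otimes>\<^bsub>A\<^esub> conj_fun f = conj_fun (conj_fun x \<otimes>\<^bsub>A\<^esub> f)"
      by (simp add: A_def conj_fun_mult)
    also have "\<dots> = x"
      using id[OF conj[OF x]] by simp
    finally have x': "x \<otimes>\<^bsub>A\<^esub> conj_fun f = x" .
    have "(x \<otimes>\<^bsub>A\<^esub> r) z = 1/2 * (x \<otimes>\<^bsub>A\<^esub> f) z + 1/2 * (x \<otimes>\<^bsub>A\<^esub> conj_fun f) z"
      by (simp add: r_def A_def group_algebra_def sum_divide_distrib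
          add_divide_distrib sum.distrib distrib_left)
    then show "(x \<otimes>\<^bsub>A\<^esub> r) z = x z"
      by (simp add: id[OF x] x')
  qed
  ultimately show thesis
    by (rule that)
qed

section \<open>Passing to the join of two left ideals\<close>

text \<open>
  Both products are the sum of the coefficients of \<open>x\<close> times the average.
\<close>

lemma subgroup_avg_central:
  assumes "group G" and "finite (carrier G)" and "x \<in> carrier (group_algebra G)"
  shows "x \<otimes>\<^bsub>group_algebra G\<^esub> subgroup_avg (carrier G) =
    subgroup_avg (carrier G) \<otimes>\<^bsub>group_algebra G\<^esub> x"
proof -
  interpret group G by fact
  have "(\<Sum>y\<in>carrier G. x (inv\<^bsub>G\<^esub> y \<otimes>\<^bsub>G\<^esub> z)) = (\<Sum>y\<in>carrier G. x y)"
    if z: "z \<in> carrier G" for z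
    by (rule sum.reindex_bij_witness[where i = "\<lambda>u. z \<otimes>\<^bsub>G\<^esub> inv\<^bsub>G\<^esub> u" and j = "\<lambda>y. inv\<^bsub>G\<^esub> y \<otimes>\<^bsub>G\<^esub> z"])
       (use z in \<open>auto simp: inv_mult_group m_assoc[symmetric]\<close>, simp_all add: m_assoc)
  then show ?thesis
    by (auto simp: group_algebra_def subgroup_avg_def fun_eq_iff simp flip: sum_divide_distrib)
qed

text \<open>
  Under \<open>e f = e\<close>, the equation \<open>e w = e w e\<close> gives \<open>e w f = e w\<close>, an equation that is linear in its
  left factor \<open>e\<close>. So is \<open>e w \<eta> = e \<eta> w \<eta>\<close>, the form that the second condition takes because
  \<open>e \<eta> = \<eta>\<close>. The same holds for \<open>e'\<close>, and left-linear equations pass to \<open>f = a e + b e'\<close>.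
\<close>

lemma (in ring) join_of_left_ideals_inherits:
  assumes carr: "e \<in> carrier R" "e' \<in> carrier R" "a \<in> carrier R" "b \<in> carrier R"
      "\<eta> \<in> carrier R" "w \<in> carrier R"
    and f: "f = a \<otimes> e \<oplus> b \<otimes> e'" and ef: "e \<otimes> f = e" "e' \<otimes> f = e'"
    and eta: "e \<otimes> \<eta> = \<eta>" "e' \<otimes> \<eta> = \<eta>" "f \<otimes> \<eta> = \<eta>"
    and e: "e \<otimes> w \<otimes> (\<one> \<ominus> e) = \<zero>" "(e \<ominus> \<eta>) \<otimes> w \<otimes> \<eta> = \<zero>"
    and e': "e' \<otimes> w \<otimes> (\<one> \<ominus> e') = \<zero>" "(e' \<ominus> \<eta>) \<otimes> w \<otimes> \<eta> = \<zero>"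
  shows "f \<otimes> f = f" "f \<otimes> w \<otimes> (\<one> \<ominus> f) = \<zero>" "(f \<ominus> \<eta>) \<otimes> w \<otimes> \<eta> = \<zero>"
proof -
  have fc: "f \<in> carrier R" using carr f by simp
  show "f \<otimes> f = f"
  proof -
    have "f \<otimes> f = a \<otimes> (e \<otimes> f) \<oplus> b \<otimes> (e' \<otimes> f)"
      using carr fc by (subst f) (simp add: l_distr m_assoc)
    then show ?thesis
      by (simp only: ef f[symmetric])
  qed
  have stable: "g \<otimes> w \<otimes> f = g \<otimes> w"
    if "g \<in> carrier R" "g \<otimes> w \<otimes> (\<one> \<ominus> g) = \<zero>" "g \<otimes> f = g" for g
  proof -
    have gw: "g \<otimes> w = g \<otimes> w \<otimes> g"
      using that carr by (simp add: a_minus_def r_distr r_minus)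
        (metis a_minus_def m_closed r_right_minus_eq)
    then have "g \<otimes> w \<otimes> f = g \<otimes> w \<otimes> (g \<otimes> f)"
      using that carr fc by (metis m_assoc m_closed)
    then show ?thesis using that gw by simp
  qed
  have "f \<otimes> w \<otimes> f = a \<otimes> (e \<otimes> w \<otimes> f) \<oplus> b \<otimes> (e' \<otimes> w \<otimes> f)"
    using carr fc by (subst f) (simp add: l_distr m_assoc)
  also have "\<dots> = a \<otimes> (e \<otimes> w) \<oplus> b \<otimes> (e' \<otimes> w)"
    by (simp only: stable[OF carr(1) e(1) ef(1)] stable[OF carr(2) e'(1) ef(2)])
  also have "\<dots> = f \<otimes> w"
    using carr by (simp add: f l_distr m_assoc)
  finally show "f \<otimes> w \<otimes> (\<one> \<ominus> f) = \<zero>"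
    using carr fc by (simp add: a_minus_def r_distr r_minus r_neg)
  have at_eta: "g \<otimes> w \<otimes> \<eta> = \<eta> \<otimes> w \<otimes> \<eta>"
    if "g \<in> carrier R" "(g \<ominus> \<eta>) \<otimes> w \<otimes> \<eta> = \<zero>" for g
    using that carr by (simp add: a_minus_def l_distr l_minus)
      (metis a_minus_def m_closed r_right_minus_eq)
  have "f \<otimes> w \<otimes> \<eta> = a \<otimes> (e \<otimes> w \<otimes> \<eta>) \<oplus> b \<otimes> (e' \<otimes> w \<otimes> \<eta>)"
    using carr by (simp add: f l_distr m_assoc)
  also have "\<dots> = (a \<otimes> (e \<otimes> \<eta>) \<oplus> b \<otimes> (e' \<otimes> \<eta>)) \<otimes> w \<otimes> \<eta>"
    using carr
    by (simp add: at_eta[OF carr(1) e(2)] at_eta[OF carr(2) e'(2)] eta l_distr m_assoc)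
  also have "a \<otimes> (e \<otimes> \<eta>) \<oplus> b \<otimes> (e' \<otimes> \<eta>) = f \<otimes> \<eta>"
    using carr by (simp add: f l_distr m_assoc)
  finally show "(f \<ominus> \<eta>) \<otimes> w \<otimes> \<eta> = \<zero>"
    using carr fc by (simp add: eta a_minus_def l_distr l_minus r_neg)
qed

theorem corollary8p3:
  fixes G :: "('a, 'm) monoid_scheme" and H :: "'a set"
  assumes "group G" and "finite (carrier G)" and "subgroup H G"
  shows "Theta G H \<inter> real_group_algebra G =
    (\<Union>e \<in> E_bullet G H \<inter> real_group_algebra (G\<lparr>carrier := H\<rparr>).
       Theta_of G H e \<inter> real_group_algebra G)"
proof (intro equalityI subsetI)
  let ?A = "group_algebra G" and ?K = "group_algebra (G\<lparr>carrier := H\<rparr>)"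
  let ?\<eta> = "subgroup_avg H"
  fix w assume "w \<in> Theta G H \<inter> real_group_algebra G"
  then obtain e where e: "e \<in> E_bullet G H" and w_e: "w \<in> Theta_of G H e"
    and w_real: "w \<in> real_group_algebra G"
    by (auto simp: Theta_def)
  have gH: "group (G\<lparr>carrier := H\<rparr>)"
    using assms by (simp add: group.subgroup_imp_group)
  have HG: "H \<subseteq> carrier G"
    using assms(3) by (simp add: subgroup.subset)
  then have finH: "finite (carrier (G\<lparr>carrier := H\<rparr>))"
    using assms(2) finite_subset by auto
  interpret A: ring ?A using assms by (intro group_algebra_ring)
  interpret K: ring ?K by (rule group_algebra_ring[OF gH finH])
  have KA: "x \<in> carrier ?A" if "x \<in> carrier ?K" for x
    using that HG by (auto simp: group_algebra_def)
  have mult_eq: "x \<otimes>\<^bsub>?K\<^esub> y = x \<otimes>\<^bsub>?A\<^esub> y" if "x \<in> carrier ?K" "y \<in> carrier ?K" for x y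
    using group_algebra_subgroup_mult[OF assms that] .
  have add_eq: "x \<oplus>\<^bsub>?K\<^esub> y = x \<oplus>\<^bsub>?A\<^esub> y" for x y
    by (simp add: group_algebra_def)
  have eta_K: "?\<eta> \<in> carrier ?K"
    by (simp add: group_algebra_def subgroup_avg_def)
  have central: "x \<otimes>\<^bsub>?A\<^esub> ?\<eta> = ?\<eta> \<otimes>\<^bsub>?A\<^esub> x" if "x \<in> carrier ?K" for x
    using subgroup_avg_central[OF gH finH that] that eta_K by (simp add: mult_eq)
  define e' where "e' = conj_fun e"
  have e_K: "e \<in> carrier ?K" and ee: "e \<otimes>\<^bsub>?A\<^esub> e = e" and eta_e: "?\<eta> \<otimes>\<^bsub>?A\<^esub> e = ?\<eta>"
    using e by (auto simp: E_bullet_def)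
  have e'_K: "e' \<in> carrier ?K"
    unfolding e'_def by (rule conj_fun_carrier[OF e_K])
  have ee': "e' \<otimes>\<^bsub>?A\<^esub> e' = e'" and eta_e': "?\<eta> \<otimes>\<^bsub>?A\<^esub> e' = ?\<eta>"
    using arg_cong[OF ee, of conj_fun] arg_cong[OF eta_e, of conj_fun]
    by (simp_all add: conj_fun_mult conj_fun_subgroup_avg e'_def)
  have w_A: "w \<in> carrier ?A" and w_conj: "conj_fun w = w"
    using w_real by (auto simp: real_group_algebra_iff)
  have w1: "e \<otimes>\<^bsub>?A\<^esub> w \<otimes>\<^bsub>?A\<^esub> (\<one>\<^bsub>?A\<^esub> \<ominus>\<^bsub>?A\<^esub> e) = \<zero>\<^bsub>?A\<^esub>"
    and w2: "(e \<ominus>\<^bsub>?A\<^esub> ?\<eta>) \<otimes>\<^bsub>?A\<^esub> w \<otimes>\<^bsub>?A\<^esub> ?\<eta> = \<zero>\<^bsub>?A\<^esub>"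
    using w_e by (auto simp: Theta_of_def)
  have w1': "e' \<otimes>\<^bsub>?A\<^esub> w \<otimes>\<^bsub>?A\<^esub> (\<one>\<^bsub>?A\<^esub> \<ominus>\<^bsub>?A\<^esub> e') = \<zero>\<^bsub>?A\<^esub>"
    and w2': "(e' \<ominus>\<^bsub>?A\<^esub> ?\<eta>) \<otimes>\<^bsub>?A\<^esub> w \<otimes>\<^bsub>?A\<^esub> ?\<eta> = \<zero>\<^bsub>?A\<^esub>"
    using arg_cong[OF w1, of conj_fun] arg_cong[OF w2, of conj_fun] KA[OF e_K] KA[OF eta_K]
    by (simp_all add: conj_fun_mult conj_fun_minus[OF assms(1,2)] conj_fun_subgroup_avg
        conj_fun_zero conj_fun_one w_conj flip: e'_def)
  define J where "J = {a \<otimes>\<^bsub>?K\<^esub> e \<oplus>\<^bsub>?K\<^esub> b \<otimes>\<^bsub>?K\<^esub> e' | a b. a \<in> carrier ?K \<and> b \<in> carrier ?K}"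
  have J_I: "a \<otimes>\<^bsub>?K\<^esub> e \<oplus>\<^bsub>?K\<^esub> b \<otimes>\<^bsub>?K\<^esub> e' \<in> J" if "a \<in> carrier ?K" "b \<in> carrier ?K" for a b
    using that by (auto simp: J_def)
  obtain f where f_J: "f \<in> J" and f_real: "f \<in> real_group_algebra (G\<lparr>carrier := H\<rparr>)"
    and f_id: "\<And>x. x \<in> J \<Longrightarrow> x \<otimes>\<^bsub>?K\<^esub> f = x"
  proof (rule conj_stable_left_ideal_has_real_right_identity[OF gH finH])
    show "J \<subseteq> carrier ?K"
      using e_K e'_K by (auto simp: J_def)
    show "\<zero>\<^bsub>?K\<^esub> \<in> J"
      using J_I[of "\<zero>\<^bsub>?K\<^esub>" "\<zero>\<^bsub>?K\<^esub>"] e_K e'_K by simp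
    show "x \<oplus>\<^bsub>?K\<^esub> y \<in> J" if x: "x \<in> J" and y: "y \<in> J" for x y
    proof -
      obtain a b c d where abcd: "a \<in> carrier ?K" "b \<in> carrier ?K" "c \<in> carrier ?K" "d \<in> carrier ?K"
        "x = a \<otimes>\<^bsub>?K\<^esub> e \<oplus>\<^bsub>?K\<^esub> b \<otimes>\<^bsub>?K\<^esub> e'" "y = c \<otimes>\<^bsub>?K\<^esub> e \<oplus>\<^bsub>?K\<^esub> d \<otimes>\<^bsub>?K\<^esub> e'"
        using x y by (auto simp: J_def)
      then have "x \<oplus>\<^bsub>?K\<^esub> y = (a \<oplus>\<^bsub>?K\<^esub> c) \<otimes>\<^bsub>?K\<^esub> e \<oplus>\<^bsub>?K\<^esub> (b \<oplus>\<^bsub>?K\<^esub> d) \<otimes>\<^bsub>?K\<^esub> e'"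
        using e_K e'_K by (simp add: K.l_distr K.a_ac)
      then show ?thesis
        using abcd by (simp add: J_I)
    qed
    show "r \<otimes>\<^bsub>?K\<^esub> x \<in> J" if r: "r \<in> carrier ?K" and x: "x \<in> J" for r x
    proof -
      obtain a b where ab: "a \<in> carrier ?K" "b \<in> carrier ?K" "x = a \<otimes>\<^bsub>?K\<^esub> e \<oplus>\<^bsub>?K\<^esub> b \<otimes>\<^bsub>?K\<^esub> e'"
        using x by (auto simp: J_def)
      then have "r \<otimes>\<^bsub>?K\<^esub> x = (r \<otimes>\<^bsub>?K\<^esub> a) \<otimes>\<^bsub>?K\<^esub> e \<oplus>\<^bsub>?K\<^esub> (r \<otimes>\<^bsub>?K\<^esub> b) \<otimes>\<^bsub>?K\<^esub> e'"
        using e_K e'_K r by (simp add: K.r_distr K.m_assoc)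
      then show ?thesis
        using ab r by (simp add: J_I)
    qed
    show "conj_fun x \<in> J" if x: "x \<in> J" for x
    proof -
      obtain a b where ab: "a \<in> carrier ?K" "b \<in> carrier ?K" "x = a \<otimes>\<^bsub>?K\<^esub> e \<oplus>\<^bsub>?K\<^esub> b \<otimes>\<^bsub>?K\<^esub> e'"
        using x by (auto simp: J_def)
      then have "conj_fun x = conj_fun b \<otimes>\<^bsub>?K\<^esub> e \<oplus>\<^bsub>?K\<^esub> conj_fun a \<otimes>\<^bsub>?K\<^esub> e'"
        using e_K e'_K
        by (simp add: conj_fun_add conj_fun_mult conj_fun_carrier e'_def K.a_comm)
      then show ?thesis
        using ab by (simp add: J_I conj_fun_carrier)
    qed
  next
    fix f assume "f \<in> J" "f \<in> real_group_algebra (G\<lparr>carrier := H\<rparr>)"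
      "\<And>x. x \<in> J \<Longrightarrow> x \<otimes>\<^bsub>?K\<^esub> f = x"
    then show thesis by (rule that)
  qed
  obtain a b where a: "a \<in> carrier ?K" and b: "b \<in> carrier ?K"
    and f_K_eq: "f = a \<otimes>\<^bsub>?K\<^esub> e \<oplus>\<^bsub>?K\<^esub> b \<otimes>\<^bsub>?K\<^esub> e'"
    using f_J by (auto simp: J_def)
  have f_eq: "f = a \<otimes>\<^bsub>?A\<^esub> e \<oplus>\<^bsub>?A\<^esub> b \<otimes>\<^bsub>?A\<^esub> e'"
    using f_K_eq a b e_K e'_K by (simp add: mult_eq add_eq)
  have f_K: "f \<in> carrier ?K"
    using f_real by (simp add: real_group_algebra_iff)
  have "e \<in> J" "e' \<in> J"
    using J_I[of "\<one>\<^bsub>?K\<^esub>" "\<zero>\<^bsub>?K\<^esub>"] J_I[of "\<zero>\<^bsub>?K\<^esub>" "\<one>\<^bsub>?K\<^esub>"] e_K e'_K by simp_all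
  then have ef: "e \<otimes>\<^bsub>?A\<^esub> f = e" and e'f: "e' \<otimes>\<^bsub>?A\<^esub> f = e'"
    using f_id e_K e'_K f_K by (simp_all flip: mult_eq)
  have "?\<eta> \<otimes>\<^bsub>?A\<^esub> f = ?\<eta> \<otimes>\<^bsub>?A\<^esub> (e \<otimes>\<^bsub>?A\<^esub> f)"
    using KA eta_K e_K f_K by (metis A.m_assoc eta_e)
  then have eta_f: "?\<eta> \<otimes>\<^bsub>?A\<^esub> f = ?\<eta>"
    by (simp add: ef eta_e)
  have "e \<otimes>\<^bsub>?A\<^esub> ?\<eta> = ?\<eta>" "e' \<otimes>\<^bsub>?A\<^esub> ?\<eta> = ?\<eta>" "f \<otimes>\<^bsub>?A\<^esub> ?\<eta> = ?\<eta>"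
    using central e_K e'_K f_K eta_e eta_e' eta_f by simp_all
  note inherited = A.join_of_left_ideals_inherits
    [OF KA[OF e_K] KA[OF e'_K] KA[OF a] KA[OF b] KA[OF eta_K] w_A f_eq ef e'f this w1 w2 w1' w2']
  have "f \<in> E_bullet G H"
    using f_K inherited(1) eta_f by (simp add: E_bullet_def)
  moreover have "w \<in> Theta_of G H f"
    using w_A inherited(2,3) by (simp add: Theta_of_def)
  ultimately show "w \<in> (\<Union>e \<in> E_bullet G H \<inter> real_group_algebra (G\<lparr>carrier := H\<rparr>).
      Theta_of G H e \<inter> real_group_algebra G)"
    using f_real w_real by blast
qed (auto simp: Theta_def)

end
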